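(* Let $S=2$, so $\mathcal{S}=\{1,2\}$, let $Q(\cdot)$ be a nonlinear generator on $\mathcal{P}(\{1,2\})$ and let $(\Phi^t(\cdot))_{t\ge0}$ be the nonlinear Markov semigroup of the nonlinear Markov chain with generator $Q(\cdot)$. Assume that $f:[0,1]\rightarrow\mathbb{R}$ defined via $$f(m_1):=m_1\cdot Q_{11}(m_1,1-m_1)+(1-m_1)\cdot Q_{21}(m_1,1-m_1)$$ is continuous. Furthermore, assume that $(\bar m,1-\bar m)$ is the unique stationary point given $Q$, that is, the unique invariant distribution. Then the nonlinear Markov chain is strongly ergodic.
   Context: $\mathcal{P}(\mathcal{S})=\{m\in\mathbb{R}^S: m_i\ge 0,\ \sum_{i\in\mathcal{S}}m_i=1\}$ is the probability simplex over the finite state space $\mathcal{S}=\{1,\ldots,S\}$. A transition rate matrix is a real $S\times S$ matrix with non-negative off-diagonal entries and all row sums equal to $0$ (conservative). A transition rate matrix function is a map $Q:\mathcal{P}(\mathcal{S})\to\mathbb{R}^{S\times S}$ such that $Q(m)$ is a transition rate matrix for every $m\in\mathcal{P}(\mathcal{S})$. A continuous family of nonlinear transition probabilities is a family of stochastic matrices $P(t,m)=(P_{ij}(t,m))_{i,j\in\mathcal{S}}$ depending continuously on $t\ge 0$ and $m\in\mathcal{P}(\mathcal{S})$ and satisfying the nonlinear Chapman-Kolmogorov equation $\sum_i m_iP_{ij}(t+s,m)=\sum_{i,k}m_iP_{ik}(t,m)P_{kj}(s,\sum_l m_lP_l(t,m))$, where $P_l(t,m)$ denotes the $l$-th row. It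 yields a nonlinear Markov semigroup $(\Phi^t(\cdot))_{t\ge0}$ of continuous transformations of $\mathcal{P}(\mathcal{S})$ via $\Phi^t_j(m)=\sum_i m_iP_{ij}(t,m)$; it satisfies $\Phi^{t+s}=\Phi^t\Phi^s$ and $\Phi^0(m)=m$. $\Phi^t(m_0)$ is the marginal distribution at time $t$ of the nonlinear Markov chain with initial distribution $m_0$. A transition rate matrix function $Q$ is the nonlinear (infinitesimal) generator of the semigroup if $\Phi^t(m)$ is differentiable in $t=0$ for all $m\in\mathcal{P}(\mathcal{S})$ and $\left.\frac{\partial}{\partial t}\Phi^t_j(m)\right|_{t=0}=\sum_i m_iQ_{ij}(m)$ for all $j\in\mathcal{S}$ and $m\in\mathcal{P}(\mathcal{S})$. By the semigroup identity, $\Phi^t(m_0)$ then solves $\frac{\partial}{\partial t}\Phi^t(m_0)=\Phi^t(m_0)Q(\Phi^t(m_0))$ (row vector convention), $\Phi^0(m_0)=m_0$. $m\in\mathcal{P}(\mathcal{S})$ is an invariant distribution (stationary point given $Q$) if $0=m^TQ(m)$. The nonlinear Markov chain with semigroup $(\Phi^t(\cdot))_{t\ge0}$ is strongly ergodic if there exists $m^*\in\mathcal{P}(\mathcal{S})$ such that $\lim_{t\to\infty}\|\Phi^t(m_0)-m^*\|=0$ for all $m_0\in\mathcal{P}(\mathcal{S})$. *)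

theory Defs
  imports "HOL-Analysis.Analysis"
begin

definition prob_simplex :: "(real ^ 'n::finite) set" where
  "prob_simplex = {m. (\<forall>i. 0 \<le> m $ i) \<and> (\<Sum>i\<in>UNIV. m $ i) = 1}"

definition transition_rate_matrix :: "real ^ 'n::finite ^ 'n \<Rightarrow> bool" where
  "transition_rate_matrix A \<longleftrightarrow>
     (\<forall>i j. i \<noteq> j \<longrightarrow> 0 \<le> A $ i $ j) \<and> (\<forall>i. (\<Sum>j\<in>UNIV. A $ i $ j) = 0)"

definition stochastic_matrix :: "real ^ 'n::finite ^ 'n \<Rightarrow> bool" where
  "stochastic_matrix A \<longleftrightarrow>
     (\<forall>i j. 0 \<le> A $ i $ j) \<and> (\<forall>i. (\<Sum>j\<in>UNIV. A $ i $ j) = 1)"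

definition transition_rate_matrix_function ::
    "(real ^ 'n::finite \<Rightarrow> real ^ 'n ^ 'n) \<Rightarrow> bool" where
  "transition_rate_matrix_function Q \<longleftrightarrow> (\<forall>m\<in>prob_simplex. transition_rate_matrix (Q m))"

text \<open>The map \<open>\<Phi>\<close> of a family \<open>P\<close>: \<open>\<Phi> t m\<close> has the components \<open>\<Sum>i. m i * P t m i j\<close>.\<close>

definition markov_flow ::
    "(real \<Rightarrow> real ^ 'n::finite \<Rightarrow> real ^ 'n ^ 'n) \<Rightarrow> real \<Rightarrow> real ^ 'n \<Rightarrow> real ^ 'n" where
  "markov_flow P t m = (\<chi> j. \<Sum>i\<in>UNIV. m $ i * P t m $ i $ j)"

text \<open>Only the values \<open>P t m\<close> with \<open>0 \<le> t\<close> and \<open>m\<close> in the simplex matter. Continuity is joint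
  in \<open>(t, m)\<close>. The last conjunct is the semigroup axiom that \<open>\<Phi> 0\<close> is the identity; the
  Chapman-Kolmogorov equation alone only makes \<open>\<Phi> 0\<close> idempotent.\<close>

definition nonlinear_transition_probabilities ::
    "(real \<Rightarrow> real ^ 'n::finite \<Rightarrow> real ^ 'n ^ 'n) \<Rightarrow> bool" where
  "nonlinear_transition_probabilities P \<longleftrightarrow>
     (\<forall>t\<ge>0. \<forall>m\<in>prob_simplex. stochastic_matrix (P t m)) \<and>
     continuous_on ({0..} \<times> prob_simplex) (\<lambda>(t, m). P t m) \<and>
     (\<forall>t\<ge>0. \<forall>s\<ge>0. \<forall>m\<in>prob_simplex. \<forall>j.
        (\<Sum>i\<in>UNIV. m $ i * P (t + s) m $ i $ j) =
        (\<Sum>i\<in>UNIV. \<Sum>k\<in>UNIV.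
           m $ i * P t m $ i $ k * P s (\<Sum>l\<in>UNIV. m $ l *\<^sub>R P t m $ l) $ k $ j)) \<and>
     (\<forall>m\<in>prob_simplex. markov_flow P 0 m = m)"

text \<open>The derivative at \<open>0\<close> is one-sided, since \<open>\<Phi> t\<close> only exists for \<open>t \<ge> 0\<close>.\<close>

definition nonlinear_generator ::
    "(real \<Rightarrow> real ^ 'n::finite \<Rightarrow> real ^ 'n) \<Rightarrow> (real ^ 'n \<Rightarrow> real ^ 'n ^ 'n) \<Rightarrow> bool" where
  "nonlinear_generator \<Phi> Q \<longleftrightarrow>
     transition_rate_matrix_function Q \<and>
     (\<forall>m\<in>prob_simplex. \<forall>j.
        ((\<lambda>t. \<Phi> t m $ j) has_real_derivative (\<Sum>i\<in>UNIV. m $ i * Q m $ i $ j))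
          (at 0 within {0..}))"

definition invariant_distribution ::
    "(real ^ 'n::finite \<Rightarrow> real ^ 'n ^ 'n) \<Rightarrow> real ^ 'n \<Rightarrow> bool" where
  "invariant_distribution Q m \<longleftrightarrow> m \<in> prob_simplex \<and> m v* Q m = 0"

definition strongly_ergodic :: "(real \<Rightarrow> real ^ 'n::finite \<Rightarrow> real ^ 'n) \<Rightarrow> bool" where
  "strongly_ergodic \<Phi> \<longleftrightarrow>
     (\<exists>m'\<in>prob_simplex. \<forall>m\<^sub>0\<in>prob_simplex. ((\<lambda>t. norm (\<Phi> t m\<^sub>0 - m')) \<longlongrightarrow> 0) at_top)"

end

theory Submission
  imports Defs
begin

text \<open>A distribution on two states is determined by its first coordinate, so the flow reduces to
  curves \<open>x\<close> in \<open>[0, 1]\<close>. Let \<open>f y\<close> be the first coordinate of \<open>m v* Q m\<close> at \<open>m = (y, 1 - y)\<close>. The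
  semigroup identity carries the generator equation at time \<open>0\<close> to every later time, but only as
  a right derivative: \<open>x\<close> is continuous with right derivative \<open>f (x t)\<close>. Since \<open>Q\<close> has rate matrices as values, \<open>f 0 \<ge> 0 \<ge> f 1\<close>, and the zeros of
  \<open>f\<close> are the first coordinates of the invariant distributions. A single zero \<open>p\<close> and the
  intermediate value theorem force \<open>f > 0\<close> to the left of \<open>p\<close> and \<open>f < 0\<close> to the right
  (\<open>unique_zero_imp_inward\<close>).

  Hence \<open>(x t - p)\<^sup>2\<close> is a Lyapunov function: its right derivative \<open>2 (x t - p) f (x t)\<close> is
  nowhere positive, and by compactness it is bounded away from \<open>0\<close> as long as \<open>x t\<close> is bounded
  away from \<open>p\<close>. The mean value inequality for right derivatives
  (\<open>right_derivative_upper_bound\<close>) then gives \<open>x t \<longlongrightarrow> p\<close>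
  (\<open>scalar_inward_flow_tendsto\<close>). Uniqueness of solutions of the differential equation, which may
  fail for merely continuous \<open>f\<close>, is not needed.\<close>

section \<open>Scalar curves given by their right derivative\<close>

lemma right_derivative_upper_bound:
  fixes g :: "real \<Rightarrow> real"
  assumes "a \<le> b" and cont: "continuous_on {a..b} g"
    and der: "\<And>t. a \<le> t \<Longrightarrow> t < b \<Longrightarrow> (g has_real_derivative g' t) (at t within {t..})"
    and bound: "\<And>t. a \<le> t \<Longrightarrow> t < b \<Longrightarrow> g' t \<le> K"
  shows "g b - g a \<le> K * (b - a)"
proof (rule field_le_epsilon)
  fix e :: real assume "e > 0"
  define d where "d = e / (b - a + 1)"
  have "d > 0" using \<open>e > 0\<close> \<open>a \<le> b\<close> by (simp add: d_def)
  define h where "h t = g t - (K + d) * t" for t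
  \<comment> \<open>The right derivative of \<open>h\<close> is negative, so a minimum of \<open>h\<close> over \<open>[a, b]\<close> can only
    be attained at \<open>b\<close>.\<close>
  have "continuous_on {a..b} h"
    unfolding h_def by (intro continuous_intros cont)
  then obtain s where s: "s \<in> {a..b}" and min: "\<And>t. t \<in> {a..b} \<Longrightarrow> h s \<le> h t"
    using continuous_attains_inf[of "{a..b}" h] \<open>a \<le> b\<close> by auto
  have "s = b"
  proof (rule ccontr)
    assume "s \<noteq> b"
    with s have "a \<le> s" "s < b" by auto
    have "(h has_real_derivative g' s - (K + d)) (at s within {s..})"
      unfolding h_def by (auto intro!: derivative_eq_intros der[OF \<open>a \<le> s\<close> \<open>s < b\<close>])
    moreover have "g' s - (K + d) < 0"
      using bound[OF \<open>a \<le> s\<close> \<open>s < b\<close>] \<open>d > 0\<close> by simp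
    ultimately obtain r where "r > 0"
      and r: "\<And>u. u > 0 \<Longrightarrow> s + u \<in> {s..} \<Longrightarrow> u < r \<Longrightarrow> h (s + u) < h s"
      using has_real_derivative_neg_dec_right by blast
    define u where "u = min (r / 2) (b - s)"
    have "u > 0" "u < r" "s + u \<le> b" using \<open>r > 0\<close> \<open>s < b\<close> by (auto simp: u_def min_def)
    then have "h (s + u) < h s" by (intro r) auto
    moreover have "h s \<le> h (s + u)" using \<open>a \<le> s\<close> \<open>u > 0\<close> \<open>s + u \<le> b\<close> by (intro min) auto
    ultimately show False by simp
  qed
  then have "g b - g a \<le> K * (b - a) + d * (b - a)"
    using min[of a] \<open>a \<le> b\<close> by (simp add: h_def algebra_simps)
  moreover have "d * (b - a) \<le> e"
    using \<open>e > 0\<close> \<open>a \<le> b\<close> by (simp add: d_def field_simps)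
  ultimately show "g b - g a \<le> K * (b - a) + e" by simp
qed

lemma unique_zero_imp_inward:
  fixes f :: "real \<Rightarrow> real"
  assumes cont: "continuous_on {a..b} f" and "f a \<ge> 0" "f b \<le> 0"
    and zero: "\<And>y. y \<in> {a..b} \<Longrightarrow> f y = 0 \<longleftrightarrow> y = p"
    and y: "y \<in> {a..b}" "y \<noteq> p"
  shows "(y - p) * f y < 0"
proof (cases "y < p")
  case True
  have "f y > 0"
  proof (rule ccontr)
    assume "\<not> f y > 0"
    then obtain z where "a \<le> z" "z \<le> y" "f z = 0"
      using IVT2'[of f y 0 a] y \<open>f a \<ge> 0\<close> continuous_on_subset[OF cont, of "{a..y}"] by auto
    with zero[of z] y True show False by auto
  qed
  with True show ?thesis by (simp add: mult_neg_pos)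
next
  case False
  have "f y < 0"
  proof (rule ccontr)
    assume "\<not> f y < 0"
    then obtain z where "y \<le> z" "z \<le> b" "f z = 0"
      using IVT2'[of f b 0 y] y \<open>f b \<le> 0\<close> continuous_on_subset[OF cont, of "{y..b}"] by auto
    with zero[of z] y False show False by auto
  qed
  with False y show ?thesis by (simp add: mult_pos_neg)
qed

text \<open>The point \<open>p\<close> is not required to lie in \<open>[a, b]\<close>; this follows from the limit.\<close>

lemma scalar_inward_flow_tendsto:
  fixes f x :: "real \<Rightarrow> real"
  assumes f: "continuous_on {a..b} f"
    and inward: "\<And>y. y \<in> {a..b} \<Longrightarrow> y \<noteq> p \<Longrightarrow> (y - p) * f y < 0"
    and x: "continuous_on {0..} x"
    and range: "\<And>t. t \<ge> 0 \<Longrightarrow> x t \<in> {a..b}"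
    and der: "\<And>t. t \<ge> 0 \<Longrightarrow> (x has_real_derivative f (x t)) (at t within {t..})"
  shows "(x \<longlongrightarrow> p) at_top"
proof -
  define V where "V t = (x t - p)\<^sup>2" for t
  have V_cont: "continuous_on {s..t} V" if "s \<ge> 0" for s t
    unfolding V_def using that by (intro continuous_intros continuous_on_subset[OF x]) auto
  have V_der: "(V has_real_derivative 2 * ((x t - p) * f (x t))) (at t within {t..})"
    if "t \<ge> 0" for t
    unfolding V_def by (auto intro!: derivative_eq_intros der[OF that])
  have V_decay: "V t - V s \<le> K * (t - s)"
    if "0 \<le> s" "s \<le> t" "\<And>u. u \<ge> 0 \<Longrightarrow> 2 * ((x u - p) * f (x u)) \<le> K" for s t K
    by (rule right_derivative_upper_bound[OF \<open>s \<le> t\<close> V_cont[OF \<open>0 \<le> s\<close>] V_der]) (use that in auto)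
  have V_antimono: "V t \<le> V s" if "0 \<le> s" "s \<le> t" for s t
  proof -
    have nonpos: "(x u - p) * f (x u) \<le> 0" if "u \<ge> 0" for u
      using inward[OF range[OF that]] by (cases "x u = p") (simp_all add: less_imp_le)
    have "2 * ((x u - p) * f (x u)) \<le> 0" if "u \<ge> 0" for u
      using mult_left_mono[OF nonpos[OF that], of 2] by simp
    from V_decay[OF that this] show ?thesis by simp
  qed
  have V_small: "\<exists>t\<ge>0. V t < e" if "e > 0" for e
  proof (rule ccontr)
    assume "\<not> ?thesis"
    then have large: "V t \<ge> e" if "t \<ge> 0" for t using that by force
    define C where "C = {a..b} \<inter> {y. e \<le> (y - p)\<^sup>2}"
    have in_C: "x t \<in> C" if "t \<ge> 0" for t
      using large[OF that] range[OF that] by (simp add: C_def V_def)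
    have "compact C"
      unfolding C_def by (intro compact_Int_closed compact_Icc closed_Collect_le continuous_intros)
    moreover have "continuous_on C (\<lambda>y. 2 * ((y - p) * f y))"
      by (intro continuous_intros continuous_on_subset[OF f]) (auto simp: C_def)
    ultimately obtain z where "z \<in> C"
      and z: "\<And>y. y \<in> C \<Longrightarrow> 2 * ((y - p) * f y) \<le> 2 * ((z - p) * f z)"
      using continuous_attains_sup[of C "\<lambda>y. 2 * ((y - p) * f y)"] in_C[of 0] by auto
    define c where "c = - (2 * ((z - p) * f z))"
    have "z \<noteq> p" using \<open>z \<in> C\<close> \<open>e > 0\<close> by (auto simp: C_def)
    with inward[of z] \<open>z \<in> C\<close> have "(z - p) * f z < 0" by (auto simp: C_def)
    then have "c > 0" by (simp add: c_def mult.commute)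
    have "V 0 \<ge> 0" by (simp add: V_def)
    \<comment> \<open>A function that starts at \<open>V 0\<close> and decays at rate at least \<open>c\<close> is no longer positive
      at time \<open>V 0 / c\<close>.\<close>
    have "V 0 / c \<ge> 0" using \<open>c > 0\<close> \<open>V 0 \<ge> 0\<close> by simp
    moreover have "2 * ((x u - p) * f (x u)) \<le> - c" if "u \<ge> 0" for u
      using z[OF in_C[OF that]] by (simp add: c_def)
    ultimately have "V (V 0 / c) - V 0 \<le> - c * (V 0 / c - 0)"
      by (intro V_decay) auto
    then have "V (V 0 / c) \<le> 0" using \<open>c > 0\<close> by simp
    with large[of "V 0 / c"] \<open>c > 0\<close> \<open>V 0 \<ge> 0\<close> \<open>e > 0\<close> show False by simp
  qed
  show ?thesis
  proof (rule tendstoI)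
    fix e :: real assume "e > 0"
    then obtain T where "T \<ge> 0" "V T < e\<^sup>2" using V_small[of "e\<^sup>2"] by auto
    have "dist (x t) p < e" if "t \<ge> T" for t
    proof -
      have "\<bar>x t - p\<bar>\<^sup>2 < e\<^sup>2"
        using V_antimono[OF \<open>T \<ge> 0\<close> that] \<open>V T < e\<^sup>2\<close> by (simp add: V_def)
      with \<open>e > 0\<close> show ?thesis by (simp add: dist_real_def power2_less_imp_less)
    qed
    then show "\<forall>\<^sub>F t in at_top. dist (x t) p < e"
      by (auto simp: eventually_at_top_linorder)
  qed
qed

section \<open>The flow of nonlinear transition probabilities\<close>

lemma markov_flow_in_prob_simplex:
  fixes m :: "real ^ 'n::finite"
  assumes "nonlinear_transition_probabilities P" "t \<ge> 0" "m \<in> prob_simplex"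
  shows "markov_flow P t m \<in> prob_simplex"
proof -
  have st: "stochastic_matrix (P t m)"
    using assms by (auto simp: nonlinear_transition_probabilities_def)
  have "(\<Sum>j\<in>UNIV. \<Sum>i\<in>UNIV. m $ i * P t m $ i $ j)
      = (\<Sum>i\<in>UNIV. m $ i * (\<Sum>j\<in>UNIV. P t m $ i $ j))"
    by (subst sum.swap) (simp add: sum_distrib_left)
  with st assms(3) show ?thesis
    by (auto simp: prob_simplex_def markov_flow_def stochastic_matrix_def intro!: sum_nonneg)
qed

lemma markov_flow_add:
  fixes m :: "real ^ 'n::finite"
  assumes "nonlinear_transition_probabilities P" "t \<ge> 0" "s \<ge> 0" "m \<in> prob_simplex"
  shows "markov_flow P (t + s) m = markov_flow P s (markov_flow P t m)"
proof -
  have flow: "(\<Sum>l\<in>UNIV. m $ l *\<^sub>R P t m $ l) = markov_flow P t m"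
    by (simp add: vec_eq_iff markov_flow_def)
  have "markov_flow P (t + s) m $ j = markov_flow P s (markov_flow P t m) $ j" for j
  proof -
    have "markov_flow P (t + s) m $ j = (\<Sum>i\<in>UNIV. \<Sum>k\<in>UNIV.
        m $ i * P t m $ i $ k * P s (markov_flow P t m) $ k $ j)"
      using assms
      by (simp add: nonlinear_transition_probabilities_def markov_flow_def[of P "t + s"] flow)
    also have "\<dots> = (\<Sum>k\<in>UNIV. \<Sum>i\<in>UNIV.
        m $ i * P t m $ i $ k * P s (markov_flow P t m) $ k $ j)"
      by (rule sum.swap)
    also have "\<dots> = (\<Sum>k\<in>UNIV. markov_flow P t m $ k * P s (markov_flow P t m) $ k $ j)"
      by (simp add: markov_flow_def[of P t] sum_distrib_right)
    finally show ?thesis by (simp add: markov_flow_def[of P s])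
  qed
  then show ?thesis by (simp add: vec_eq_iff)
qed

lemma continuous_on_markov_flow:
  fixes m :: "real ^ 'n::finite"
  assumes "nonlinear_transition_probabilities P" "m \<in> prob_simplex"
  shows "continuous_on {0..} (\<lambda>t. markov_flow P t m)"
proof -
  have "continuous_on ({0..} \<times> prob_simplex) (\<lambda>(t, m). P t m)"
    using assms by (simp add: nonlinear_transition_probabilities_def)
  moreover have "continuous_on {0..} (\<lambda>t. (t, m))" by (intro continuous_intros)
  moreover have "(\<lambda>t. (t, m)) ` {0..} \<subseteq> {0..} \<times> prob_simplex" using assms(2) by auto
  ultimately have "continuous_on {0..} (\<lambda>t. P t m)"
    using continuous_on_compose2 by fastforce
  then show ?thesis
    unfolding markov_flow_def by (intro continuous_intros) auto
qed

text \<open>The derivative is one-sided also at \<open>t > 0\<close>: restarting the flow at time \<open>t\<close> says nothing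
  about times before \<open>t\<close>.\<close>

lemma markov_flow_right_derivative:
  fixes m :: "real ^ 'n::finite"
  assumes P: "nonlinear_transition_probabilities P" and Q: "nonlinear_generator (markov_flow P) Q"
    and t: "t \<ge> 0" and m: "m \<in> prob_simplex"
  shows "((\<lambda>s. markov_flow P s m $ j) has_real_derivative
      (\<Sum>i\<in>UNIV. markov_flow P t m $ i * Q (markov_flow P t m) $ i $ j)) (at t within {t..})"
    (is "(_ has_real_derivative ?D) _")
proof -
  let ?n = "markov_flow P t m"
  have "((\<lambda>s. markov_flow P s ?n $ j) has_real_derivative ?D) (at 0 within {0..})"
    using Q markov_flow_in_prob_simplex[OF P t m] by (simp add: nonlinear_generator_def)
  moreover have "(\<lambda>s. s - t) ` {t..} \<subseteq> {0..}" by auto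
  ultimately have outer: "((\<lambda>s. markov_flow P s ?n $ j) has_real_derivative ?D)
      (at (t - t) within (\<lambda>s. s - t) ` {t..})"
    by (auto intro: DERIV_subset)
  have "((\<lambda>s. s - t) has_real_derivative 1) (at t within {t..})"
    by (auto intro!: derivative_eq_intros)
  from DERIV_image_chain[OF outer this]
  have "((\<lambda>s. markov_flow P (s - t) ?n $ j) has_real_derivative ?D) (at t within {t..})"
    by (simp add: o_def)
  then show ?thesis
  proof (rule has_field_derivative_transform_within[OF _ zero_less_one])
    show "markov_flow P (s - t) ?n $ j = markov_flow P s m $ j" if "s \<in> {t..}" for s
      using markov_flow_add[OF P t _ m, of "s - t"] that by simp
  qed simp
qed

section \<open>Strong ergodicity on two states\<close>

lemma vector_in_prob_simplex_iff:
  "vector [x, 1 - x] \<in> (prob_simplex :: (real ^ 2) set) \<longleftrightarrow> x \<in> {0..1}"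
  by (auto simp: prob_simplex_def forall_2 sum_2)

lemma prob_simplex_2_eq_vector:
  fixes m :: "real ^ 2"
  assumes "m \<in> prob_simplex"
  shows "m = vector [m $ 1, 1 - m $ 1]"
  using assms by (auto simp: prob_simplex_def vec_eq_iff forall_2 sum_2)

theorem theorem5p1:
  fixes P :: "real \<Rightarrow> real ^ 2 \<Rightarrow> real ^ 2 ^ 2"
    and Q :: "real ^ 2 \<Rightarrow> real ^ 2 ^ 2"
    and mbar :: real
  assumes "nonlinear_transition_probabilities P"
    and "nonlinear_generator (markov_flow P) Q"
    and "continuous_on {0..1}
           (\<lambda>x. x * Q (vector [x, 1 - x]) $ 1 $ 1 + (1 - x) * Q (vector [x, 1 - x]) $ 2 $ 1)"
    and "\<And>m. invariant_distribution Q m \<longleftrightarrow> m = vector [mbar, 1 - mbar]"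
  shows "strongly_ergodic (markov_flow P)"
proof -
  define f where
    "f x = x * Q (vector [x, 1 - x]) $ 1 $ 1 + (1 - x) * Q (vector [x, 1 - x]) $ 2 $ 1" for x
  have f: "continuous_on {0..1} f" unfolding f_def by (fact assms(3))
  have rates: "0 \<le> Q (vector [x, 1 - x]) $ 2 $ 1"
    "0 \<le> Q (vector [x, 1 - x]) $ 1 $ 2"
    "Q (vector [x, 1 - x]) $ 1 $ 1 = - Q (vector [x, 1 - x]) $ 1 $ 2"
    "Q (vector [x, 1 - x]) $ 2 $ 2 = - Q (vector [x, 1 - x]) $ 2 $ 1" if "x \<in> {0..1}" for x
  proof -
    have "transition_rate_matrix (Q (vector [x, 1 - x]))"
      using assms(2) that
      by (simp add: nonlinear_generator_def transition_rate_matrix_function_def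
          vector_in_prob_simplex_iff)
    then show "0 \<le> Q (vector [x, 1 - x]) $ 2 $ 1"
      "0 \<le> Q (vector [x, 1 - x]) $ 1 $ 2"
      "Q (vector [x, 1 - x]) $ 1 $ 1 = - Q (vector [x, 1 - x]) $ 1 $ 2"
      "Q (vector [x, 1 - x]) $ 2 $ 2 = - Q (vector [x, 1 - x]) $ 2 $ 1"
      by (auto simp: transition_rate_matrix_def forall_2 sum_2)
  qed
  have zero: "f x = 0 \<longleftrightarrow> x = mbar" if x: "x \<in> {0..1}" for x
  proof -
    \<comment> \<open>The rows of \<open>Q\<close> sum to \<open>0\<close>, so the second coordinate of \<open>m v* Q m\<close> is \<open>- f x\<close>.\<close>
    have "f x = 0 \<longleftrightarrow> invariant_distribution Q (vector [x, 1 - x])"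
      using x rates[OF x]
      by (auto simp: f_def invariant_distribution_def vector_in_prob_simplex_iff vec_eq_iff
          vector_matrix_mult_def forall_2 sum_2 algebra_simps)
    also have "\<dots> \<longleftrightarrow> x = mbar"
      unfolding assms(4) by (auto simp: vec_eq_iff forall_2)
    finally show ?thesis .
  qed
  have "f 0 \<ge> 0" using rates[of 0] by (simp add: f_def)
  have "f 1 \<le> 0" using rates[of 1] by (simp add: f_def)
  have inward: "(y - mbar) * f y < 0" if "y \<in> {0..1}" "y \<noteq> mbar" for y
    using unique_zero_imp_inward[OF f \<open>f 0 \<ge> 0\<close> \<open>f 1 \<le> 0\<close> zero that] by simp
  define mstar :: "real ^ 2" where "mstar = vector [mbar, 1 - mbar]"
  have "mstar \<in> prob_simplex"
    using assms(4)[of mstar] by (simp add: mstar_def invariant_distribution_def)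
  moreover have "((\<lambda>t. norm (markov_flow P t m - mstar)) \<longlongrightarrow> 0) at_top"
    if m: "m \<in> prob_simplex" for m
  proof -
    define x where "x t = markov_flow P t m $ 1" for t
    have flow: "markov_flow P t m = vector [x t, 1 - x t]" "x t \<in> {0..1}" if "t \<ge> 0" for t
    proof -
      have "markov_flow P t m \<in> prob_simplex"
        by (rule markov_flow_in_prob_simplex[OF assms(1) that m])
      then show "markov_flow P t m = vector [x t, 1 - x t]" "x t \<in> {0..1}"
        using prob_simplex_2_eq_vector[of "markov_flow P t m"]
          vector_in_prob_simplex_iff[of "x t"] by (simp_all add: x_def)
    qed
    have x_cont: "continuous_on {0..} x"
      unfolding x_def by (intro continuous_intros continuous_on_markov_flow[OF assms(1) m])
    have x_der: "(x has_real_derivative f (x t)) (at t within {t..})" if "t \<ge> 0" for t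
      using markov_flow_right_derivative[OF assms(1,2) that m, of 1]
      unfolding flow(1)[OF that] by (simp add: x_def[abs_def] f_def sum_2)
    have x_lim: "(x \<longlongrightarrow> mbar) at_top"
      by (rule scalar_inward_flow_tendsto[OF f inward x_cont flow(2) x_der])
    have ev: "\<forall>\<^sub>F t in at_top. vector [x t, 1 - x t] = markov_flow P t m"
      using eventually_ge_at_top[of 0] by eventually_elim (simp add: flow(1))
    have "((\<lambda>t. vector [x t, 1 - x t] :: real ^ 2) \<longlongrightarrow> mstar) at_top"
    proof (rule vec_tendstoI)
      show "((\<lambda>t. (vector [x t, 1 - x t] :: real ^ 2) $ i) \<longlongrightarrow> mstar $ i) at_top" for i
        using exhaust_2[of i] by (auto simp: mstar_def intro: x_lim tendsto_diff[OF tendsto_const x_lim])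
    qed
    with ev have "((\<lambda>t. markov_flow P t m) \<longlongrightarrow> mstar) at_top"
      by (rule Lim_transform_eventually[rotated])
    then show ?thesis by (intro tendsto_norm_zero) (simp add: LIM_zero_iff)
  qed
  ultimately show ?thesis by (auto simp: strongly_ergodic_def)
qed

end
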